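(* Let $C$ be a self-dual $\mathbb{Z}_4$-code of length $36$ such that its residue code $C^{(1)}$ is a binary doubly even $[36,6,16]$ code and its torsion code $C^{(2)}$ has minimum weight $3$. Then $A_4(C)$ is a unimodular lattice with $\min(A_4(C))=3$ and $\sigma(A_4(C))=20$.
   Context: Codes: A $\mathbb{Z}_4$-code $C$ of length $n$ is a $\mathbb{Z}_4$-submodule of $\mathbb{Z}_4^n$, where $\mathbb{Z}_4=\mathbb{Z}/4\mathbb{Z}$. Its dual is $C^\perp=\{x\in\mathbb{Z}_4^n\mid x\cdot y=0\text{ for all }y\in C\}$, with $x\cdot y=\sum_i x_iy_i$, and $C$ is self-dual if $C=C^\perp$. The residue code is the binary code $C^{(1)}=\{c \bmod 2\mid c\in C\}$ and the torsion code is the binary code $C^{(2)}=\{c\bmod 2\mid c\in\mathbb{Z}_4^n,\ 2c\in C\}$. A binary $[n,k]$ code is a $k$-dimensional subspace of $\mathbb{F}_2^n$; it is an $[n,k,d]$ code if its minimum weight (smallest Hamming weight of a nonzero codeword) is $d$; it is doubly even if all codeword weights are divisible by $4$. Construction A: for a self-dual $\mathbb{Z}_4$-code $C$ of length $n$, $A_4(C)=\frac{1}{2}\{(x_1,\dots,x_n)\in\mathbb{Z}^n\mid (x_1\bmod 4,\dots,x_n\bmod 4)\in C\}$. Lattices: A lattice $L \subset \mathbb{R}^n$ of full rank $n$ is unimodular if $L=L^*$, where $L^*=\{x\in\mathbb{R}^n \mid (x,y)\in\mathbb{Z}\text{ for all }y\in L\}$ and $(x,y)$ is the standard inner product. The norm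 of $x$ is $(x,x)$, and $\min(L)$ is the smallest norm of a nonzero vector of $L$. A unimodular lattice is even if all its vectors have even norm, and odd otherwise; even unimodular lattices exist only in dimensions divisible by $8$, so a unimodular lattice in dimension $36$ is odd. For an odd unimodular lattice $L$, the even sublattice is $L_0=\{x\in L\mid (x,x)\in 2\mathbb{Z}\}$, the shadow is $S(L)=L_0^*\setminus L$, and $\sigma(L)=4\min(S(L))$, where $\min(S(L))$ is the minimum norm of a vector in $S(L)$. *)

theory Defs
  imports "HOL-Analysis.Analysis" "HOL-Library.Z2"
begin

text \<open>
  \<open>\<int>\<^sub>4\<close> is the numeral type \<open>4\<close> (a \<open>comm_ring_1\<close> in which \<^term>\<open>of_int :: int \<Rightarrow> 4\<close> is reduction
  modulo 4), \<open>\<bbbF>\<^sub>2\<close> is the field \<^typ>\<open>bit\<close>, and coordinates are indexed by a finite type \<open>'n\<close>,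
  so that the length of a code and the dimension of a lattice is \<open>CARD('n)\<close>.
\<close>

lemma module_vec_scale: "module ((*s) :: 'a::comm_ring_1 \<Rightarrow> 'a ^ 'n \<Rightarrow> 'a ^ 'n)"
  by unfold_locales (vector algebra_simps)+

definition z4_code :: "(4 ^ 'n::finite) set \<Rightarrow> bool" where
  "z4_code C \<longleftrightarrow> module.subspace (*s) C"

definition dual_code :: "(4 ^ 'n::finite) set \<Rightarrow> (4 ^ 'n) set" where
  "dual_code C = {x. \<forall>y\<in>C. (\<Sum>i\<in>UNIV. x $ i * y $ i) = 0}"

definition self_dual_code :: "(4 ^ 'n::finite) set \<Rightarrow> bool" where
  "self_dual_code C \<longleftrightarrow> z4_code C \<and> C = dual_code C"

text \<open>
  \<^term>\<open>Rep_bit0\<close> yields the representative of a residue class in \<open>{0..<4}\<close>; see \<open>z4_mod2_of_int\<close>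
  below.
\<close>

definition z4_mod2 :: "4 \<Rightarrow> bit" where
  "z4_mod2 a = of_int (Rep_bit0 a)"

lemma z4_mod2_of_int: "z4_mod2 (of_int k) = of_int k"
proof -
  have "Rep_bit0 (of_int k :: 4) = k mod 4"
    by (simp add: bit0.of_int_eq Abs_bit0_inverse)
  moreover have "of_int (k mod 4) = (of_int k :: bit)"
  proof -
    have "k = 2 * (2 * (k div 4)) + k mod 4" by simp
    then have "(of_int k :: bit) = of_int (2 * (2 * (k div 4))) + of_int (k mod 4)"
      by (metis of_int_add)
    also have "(of_int (2 * (2 * (k div 4))) :: bit) = 0"
      by (simp only: of_int_mult of_int_numeral) simp
    finally show ?thesis by simp
  qed
  ultimately show ?thesis by (simp add: z4_mod2_def)
qed

definition vec_mod2 :: "4 ^ 'n::finite \<Rightarrow> bit ^ 'n" where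
  "vec_mod2 c = (\<chi> i. z4_mod2 (c $ i))"

definition residue_code :: "(4 ^ 'n::finite) set \<Rightarrow> (bit ^ 'n) set" where
  "residue_code C = {vec_mod2 c |c. c \<in> C}"

definition torsion_code :: "(4 ^ 'n::finite) set \<Rightarrow> (bit ^ 'n) set" where
  "torsion_code C = {vec_mod2 c |c. 2 *s c \<in> C}"

definition hamming_weight :: "bit ^ 'n::finite \<Rightarrow> nat" where
  "hamming_weight x = card {i. x $ i \<noteq> 0}"

text \<open>
  Minima are expressed as relations, so that they are attained by definition and no value is
  assigned to the minimum of an empty set.
\<close>

definition has_min_weight :: "(bit ^ 'n::finite) set \<Rightarrow> nat \<Rightarrow> bool" where
  "has_min_weight D d \<longleftrightarrow>
     (\<exists>x\<in>D. x \<noteq> 0 \<and> hamming_weight x = d) \<and> (\<forall>x\<in>D. x \<noteq> 0 \<longrightarrow> d \<le> hamming_weight x)"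

definition binary_code :: "nat \<Rightarrow> nat \<Rightarrow> nat \<Rightarrow> (bit ^ 'n::finite) set \<Rightarrow> bool" where
  "binary_code n k d D \<longleftrightarrow>
     CARD('n) = n \<and> vec.subspace D \<and> vec.dim D = k \<and> has_min_weight D d"

definition doubly_even :: "(bit ^ 'n::finite) set \<Rightarrow> bool" where
  "doubly_even D \<longleftrightarrow> (\<forall>x\<in>D. 4 dvd hamming_weight x)"

text \<open>A lattice of full rank is a discrete subgroup of \<open>\<real>\<^sup>n\<close> that spans \<open>\<real>\<^sup>n\<close> over \<open>\<real>\<close>.\<close>

definition full_lattice :: "(real ^ 'n::finite) set \<Rightarrow> bool" where
  "full_lattice L \<longleftrightarrow>
     0 \<in> L \<and> (\<forall>x\<in>L. \<forall>y\<in>L. x - y \<in> L) \<and> discrete L \<and> span L = UNIV"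

definition dual_lattice :: "(real ^ 'n::finite) set \<Rightarrow> (real ^ 'n) set" where
  "dual_lattice L = {x. \<forall>y\<in>L. x \<bullet> y \<in> \<int>}"

definition unimodular :: "(real ^ 'n::finite) set \<Rightarrow> bool" where
  "unimodular L \<longleftrightarrow> full_lattice L \<and> L = dual_lattice L"

definition is_min_norm :: "(real ^ 'n::finite) set \<Rightarrow> real \<Rightarrow> bool" where
  "is_min_norm S m \<longleftrightarrow> (\<exists>x\<in>S. x \<bullet> x = m) \<and> (\<forall>x\<in>S. m \<le> x \<bullet> x)"

definition has_lattice_min :: "(real ^ 'n::finite) set \<Rightarrow> real \<Rightarrow> bool" where
  "has_lattice_min L m \<longleftrightarrow> is_min_norm (L - {0}) m"

definition even_sublattice :: "(real ^ 'n::finite) set \<Rightarrow> (real ^ 'n) set" where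
  "even_sublattice L = {x \<in> L. \<exists>k::int. x \<bullet> x = 2 * of_int k}"

definition shadow :: "(real ^ 'n::finite) set \<Rightarrow> (real ^ 'n) set" where
  "shadow L = dual_lattice (even_sublattice L) - L"

text \<open>
  The shadow is only meaningful for odd \<open>L\<close>; for an even unimodular \<open>L\<close> it is empty by this formula,
  and then \<open>has_sigma L s\<close> is false for every \<open>s\<close>.
\<close>

definition has_sigma :: "(real ^ 'n::finite) set \<Rightarrow> real \<Rightarrow> bool" where
  "has_sigma L s \<longleftrightarrow> (\<exists>m. is_min_norm (shadow L) m \<and> s = 4 * m)"

definition construction_A4 :: "(4 ^ 'n::finite) set \<Rightarrow> (real ^ 'n) set" where
  "construction_A4 C =
     {(1 / 2) *\<^sub>R (\<chi> i. of_int (x $ i)) |x :: int ^ 'n. (\<chi> i. of_int (x $ i)) \<in> C}"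

end

theory Submission
  imports Defs "HOL-Number_Theory.Cong"
begin

text \<open>
  Write \<open>A\<^sub>4(C) = M / 2\<close> for the integral preimage \<open>M\<close> of \<open>C\<close>, which is self-dual modulo 4. Some
  \<open>z\<close> with all entries odd satisfies \<open>x \<cdot> x \<equiv> 2 (z \<cdot> x)\<close> modulo 8 on \<open>M\<close>, and the shadow is
  \<open>(z + M) / 2\<close>; so for \<open>v \<in> z + M\<close> one has \<open>v \<cdot> v \<equiv> 36 \<equiv> 4\<close> modulo 8. The second power moment of
  the residue code, whose dual is the torsion code, forces all nonzero weights to be 16 or 20; so
  \<open>v\<close> has at least 16 odd entries, whence \<open>v \<cdot> v \<ge> 20\<close>. For a residue word of weight 16, the vector \<open>v\<close> has 20 odd entries, and its even
  entries can be cleared modulo 4 by a torsion word, so that the bound is attained.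
\<close>

section \<open>Bilinear products and separation from subspaces\<close>

definition vdot :: "'a::comm_ring_1 ^ 'n::finite \<Rightarrow> 'a ^ 'n \<Rightarrow> 'a" (infixl "\<odot>" 70) where
  "x \<odot> y = (\<Sum>i\<in>UNIV. x $ i * y $ i)"

text \<open>With target \<open>4\<close> or \<open>bit\<close> this is reduction of an integer
  vector, with target \<open>real\<close> its inclusion.\<close>

definition of_int_vec :: "int ^ 'n \<Rightarrow> 'a::ring_1 ^ 'n" where
  "of_int_vec x = (\<chi> i. of_int (x $ i))"

lemma of_int_vec_nth [simp]: "of_int_vec x $ i = of_int (x $ i)"
  by (simp add: of_int_vec_def)

lemma of_int_vec_add: "of_int_vec (x + y) = of_int_vec x + of_int_vec y"
  and of_int_vec_0: "of_int_vec 0 = 0"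
  by (simp_all add: vec_eq_iff)

lemma vdot_commute: "x \<odot> y = y \<odot> x"
  by (simp add: vdot_def mult.commute)

lemma vdot_add_left: "(x + y) \<odot> z = x \<odot> z + y \<odot> z"
  and vdot_diff_left: "(x - y) \<odot> z = x \<odot> z - y \<odot> z"
  and vdot_scale_left: "(a *s x) \<odot> z = a * (x \<odot> z)"
  and vdot_0_left: "0 \<odot> z = 0"
  by (simp_all add: vdot_def algebra_simps sum.distrib sum_subtractf sum_distrib_left)

lemma vdot_add_right: "z \<odot> (x + y) = z \<odot> x + z \<odot> y"
  and vdot_diff_right: "z \<odot> (x - y) = z \<odot> x - z \<odot> y"
  and vdot_scale_right: "z \<odot> (a *s x) = a * (z \<odot> x)"
  and vdot_0_right: "z \<odot> 0 = 0"
  by (simp_all add: vdot_def algebra_simps sum.distrib sum_subtractf sum_distrib_left)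

lemmas vdot_simps = vdot_add_left vdot_diff_left vdot_scale_left vdot_0_left
  vdot_add_right vdot_diff_right vdot_scale_right vdot_0_right

lemma vdot_axis [simp]: "x \<odot> axis i a = x $ i * a"
proof -
  have "x \<odot> axis i a = (\<Sum>j\<in>UNIV. if j = i then x $ j * a else 0)"
    unfolding vdot_def by (intro sum.cong) (auto simp: axis_def)
  then show ?thesis by simp
qed

lemma vdot_of_int_vec: "of_int_vec x \<odot> of_int_vec y = of_int (x \<odot> y)"
  by (simp add: vdot_def)

text \<open>A basis of \<open>D\<close> stays independent after adjoining \<open>b\<close>, so some
  linear map kills \<open>D\<close> but not \<open>b\<close>. This supplies the double-dual argument
  for codes.\<close>

lemma subspace_separation:
  fixes D :: "('a::field ^ 'n::finite) set"
  assumes "vec.subspace D" "b \<notin> D"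
  obtains w where "\<And>d. d \<in> D \<Longrightarrow> w \<odot> d = 0" "w \<odot> b = 1"
proof -
  obtain B where B: "B \<subseteq> D" "vec.independent B" "D \<subseteq> vec.span B"
    using vec.basis_exists[of D] by metis
  then have spB: "vec.span B = D"
    using assms(1) vec.span_minimal by blast
  have "vec.independent (insert b B)"
    using B assms(2) spB by (simp add: vec.independent_insert)
  then obtain g where g: "Vector_Spaces.linear (*s) (*s) g"
      "\<forall>x\<in>insert b B. g x = (if x = b then 1 else 0 :: 'a ^ 'n)"
    using vec.linear_independent_extend
      [of "insert b B" "\<lambda>x. if x = b then 1 else 0 :: 'a ^ 'n"] by auto
  interpret g: Vector_Spaces.linear "(*s)" "(*s)" g by (fact g(1))
  have gB: "g x = 0" if "x \<in> B" for x
    using g(2) that B(1) assms(2) by auto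
  have gD: "g d = 0" if "d \<in> D" for d
    using vec.linear_eq_0_on_span[OF g(1) gB] that spB by blast
  \<comment> \<open>\<open>g b\<close> is the all-ones vector, so every row of the matrix of
    \<open>g\<close> serves; \<open>undefined\<close> is an arbitrary index.\<close>
  define w where "w = matrix g $ undefined"
  have "w \<odot> x = g x $ undefined" for x
    using matrix_works[OF g(1), of x]
    by (simp add: w_def vdot_def matrix_vector_mult_def vec_eq_iff)
  then show ?thesis
    using that[of w] gD g(2) by simp
qed

section \<open>Reduction of integer vectors modulo 2 and 4\<close>

lemma of_int_bit_eq_0_iff: "(of_int k :: bit) = 0 \<longleftrightarrow> even k"
proof
  assume "(of_int k :: bit) = 0"
  show "even k"
  proof (rule ccontr)
    assume "odd k"
    then obtain j where "k = 2 * j + 1" by (rule oddE)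
    then have "(of_int k :: bit) = 1" by simp
    with \<open>of_int k = 0\<close> show False by simp
  qed
qed (auto elim!: evenE)

lemma of_int_bit_eq_iff: "(of_int j :: bit) = of_int k \<longleftrightarrow> even (j - k)"
  using of_int_bit_eq_0_iff[of "j - k"] by (metis of_int_diff right_minus_eq)

lemma of_int_4_eq_0_iff: "(of_int k :: 4) = 0 \<longleftrightarrow> 4 dvd k"
proof -
  have "(of_int k :: 4) = Abs_bit0 (k mod 4)" by (simp add: bit0.of_int_eq)
  moreover have "(0 :: 4) = Abs_bit0 0" by (rule bit0.zero_def)
  moreover have "Abs_bit0 (k mod 4) = (Abs_bit0 0 :: 4) \<longleftrightarrow> k mod 4 = 0"
    by (subst Abs_bit0_inject) auto
  ultimately show ?thesis by (simp add: dvd_eq_mod_eq_0)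
qed

lemma surj_of_int_vec_4: "\<exists>x. of_int_vec x = (c :: 4 ^ 'n::finite)"
proof -
  have "\<forall>i. \<exists>k. of_int k = c $ i"
    by (metis bit0.cases)
  then obtain f where "\<forall>i. of_int (f i) = c $ i" by metis
  then show ?thesis by (intro exI[of _ "vec_lambda f"]) (simp add: vec_eq_iff)
qed

text \<open>Entries 0 and 1 make the squared length of the lift equal to the weight of the
  word.\<close>

definition bit_lift :: "bit ^ 'n \<Rightarrow> int ^ 'n" where
  "bit_lift b = (\<chi> i. of_bool (b $ i \<noteq> 0))"

lemma of_int_vec_bit_lift [simp]: "of_int_vec (bit_lift b) = b"
  by (simp add: bit_lift_def vec_eq_iff)

lemma vec_mod2_of_int_vec: "vec_mod2 (of_int_vec x) = of_int_vec x"
  by (simp add: vec_mod2_def vec_eq_iff z4_mod2_of_int)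

lemma of_int_vec_bit_eq_iff:
  "(of_int_vec x :: bit ^ 'n::finite) = of_int_vec y \<longleftrightarrow> (\<exists>t. x = y + 2 *s t)"
proof
  assume *: "(of_int_vec x :: bit ^ 'n) = of_int_vec y"
  have "x $ i = y $ i + 2 * ((x $ i - y $ i) div 2)" for i
    using * by (auto simp: vec_eq_iff of_int_bit_eq_iff)
  then show "\<exists>t. x = y + 2 *s t"
    by (intro exI[of _ "\<chi> i. (x $ i - y $ i) div 2"]) (simp add: vec_eq_iff)
qed (auto simp: vec_eq_iff of_int_bit_eq_iff)

lemma hamming_weight_of_int_vec:
  "hamming_weight (of_int_vec x) = card {i. odd (x $ i)}"
  by (simp add: hamming_weight_def of_int_bit_eq_0_iff)

section \<open>Squared lengths modulo 8 and Hamming weights\<close>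

lemma square_cong_8:
  "[k * k = of_bool (odd k) + 4 * of_bool (k mod 4 = 2)] (mod (8::int))"
proof -
  \<comment> \<open>Replacing \<open>k\<close> by \<open>k + 4\<close> changes the square by
    \<open>8 * (k + 2)\<close>, so the class modulo 4 decides.\<close>
  consider j where "k = 4 * j" | j where "k = 4 * j + 1" | j where "k = 4 * j + 2"
    | j where "k = 4 * j + 3"
  proof -
    have "k = 4 * (k div 4) \<or> k = 4 * (k div 4) + 1 \<or> k = 4 * (k div 4) + 2 \<or> k = 4 * (k div 4) + 3"
      by presburger
    then show ?thesis using that by blast
  qed
  then show ?thesis
  proof cases
    case (1 j)
    have "k * k - 0 = 8 * (2 * j * j)" by (simp add: 1 algebra_simps)
    then have "8 dvd k * k - 0" by (rule dvdI)
    moreover have "even k" "k mod 4 = 0" by (simp_all add: 1)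
    ultimately show ?thesis by (simp add: cong_iff_dvd_diff)
  next
    case (2 j)
    have "k * k - 1 = 8 * (2 * j * j + j)" by (simp add: 2 algebra_simps)
    then have "8 dvd k * k - 1" by (rule dvdI)
    moreover have "odd k" "k mod 4 = 1" by (simp_all add: 2)
    ultimately show ?thesis by (simp add: cong_iff_dvd_diff)
  next
    case (3 j)
    have "k * k - 4 = 8 * (2 * j * j + 2 * j)" by (simp add: 3 algebra_simps)
    then have "8 dvd k * k - 4" by (rule dvdI)
    moreover have "even k" "k mod 4 = 2" by (simp_all add: 3)
    ultimately show ?thesis by (simp add: cong_iff_dvd_diff)
  next
    case (4 j)
    have "k * k - 1 = 8 * (2 * j * j + 3 * j + 1)" by (simp add: 4 algebra_simps)
    then have "8 dvd k * k - 1" by (rule dvdI)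
    moreover have "odd k" "k mod 4 = 3" by (simp_all add: 4)
    ultimately show ?thesis by (simp add: cong_iff_dvd_diff)
  qed
qed

lemma vdot_self_cong_8:
  "[x \<odot> x = int (card {i. odd (x $ i)}) + 4 * int (card {i. x $ i mod 4 = 2})] (mod 8)"
proof -
  have "[x \<odot> x = (\<Sum>i\<in>UNIV. of_bool (odd (x $ i)) + 4 * of_bool (x $ i mod 4 = 2))] (mod 8)"
    unfolding vdot_def by (intro cong_sum square_cong_8)
  then show ?thesis
    by (simp add: sum.distrib sum_of_bool_eq flip: sum_distrib_left)
qed

lemma vdot_self_ge_card_nonzero: "int (card {i. x $ i \<noteq> 0}) \<le> x \<odot> x"
proof -
  have sq: "of_bool (k \<noteq> 0) \<le> k * k" for k :: int
    by (auto simp: int_one_le_iff_zero_less zero_less_mult_iff)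
  have "(\<Sum>i\<in>UNIV. of_bool (x $ i \<noteq> 0)) \<le> x \<odot> x"
    unfolding vdot_def by (intro sum_mono sq)
  then show ?thesis by (simp add: sum_of_bool_eq)
qed

lemma hamming_weight_le_vdot_self: "int (hamming_weight (of_int_vec x)) \<le> x \<odot> x"
proof -
  have "card {i. odd (x $ i)} \<le> card {i. x $ i \<noteq> 0}"
    by (intro card_mono) auto
  then show ?thesis
    using vdot_self_ge_card_nonzero[of x] by (simp add: hamming_weight_of_int_vec)
qed

lemma vdot_bit_lift_self: "bit_lift b \<odot> bit_lift b = int (hamming_weight b)"
proof -
  have "bit_lift b \<odot> bit_lift b = (\<Sum>i\<in>UNIV. of_bool (b $ i \<noteq> 0))"
    unfolding vdot_def bit_lift_def by (intro sum.cong) auto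
  then show ?thesis by (simp add: hamming_weight_def sum_of_bool_eq)
qed

section \<open>Size and weights of binary linear codes\<close>

lemma finite_bit_vec: "finite (A :: (bit ^ 'n::finite) set)"
proof (rule finite_subset)
  show "A \<subseteq> (\<lambda>S. \<chi> i. of_bool (i \<in> S)) ` UNIV"
  proof
    fix x assume "x \<in> A"
    have "x = (\<chi> i. of_bool (i \<in> {i. x $ i \<noteq> 0}))"
      by (simp add: vec_eq_iff)
    then show "x \<in> (\<lambda>S. \<chi> i. of_bool (i \<in> S)) ` UNIV"
      by blast
  qed
qed simp

text \<open>Over \<open>bit\<close>, adjoining an independent vector \<open>b\<close> adds just the
  disjoint coset of \<open>b\<close>, which doubles the span.\<close>

lemma card_bit_subspace:
  fixes D :: "(bit ^ 'n::finite) set"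
  assumes "vec.subspace D"
  shows "card D = 2 ^ vec.dim D"
proof -
  have card_span: "card (vec.span B) = 2 ^ card B"
    if "finite B" "vec.independent B" for B :: "(bit ^ 'n) set"
    using that
  proof (induction B rule: finite_induct)
    case (insert b B)
    have ind: "vec.independent B" and b: "b \<notin> vec.span B"
      using insert.prems insert.hyps(2) by (auto simp: vec.independent_insert)
    have bit: "(\<exists>k::bit. P k) \<longleftrightarrow> P 0 \<or> P 1" for P
      by (metis bit_not_zero_iff)
    have "vec.span (insert b B) = vec.span B \<union> (+) b ` vec.span B"
    proof (rule set_eqI)
      fix x
      have "x \<in> (+) b ` vec.span B \<longleftrightarrow> x - b \<in> vec.span B"
        by (metis (no_types) add_diff_cancel_left' diff_add_cancel add.commute image_iff)
      then show "x \<in> vec.span (insert b B) \<longleftrightarrow> x \<in> vec.span B \<union> (+) b ` vec.span B"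
        by (simp add: vec.span_insert bit)
    qed
    moreover have "vec.span B \<inter> (+) b ` vec.span B = {}"
      using b vec.span_add_eq2 by blast
    ultimately have "card (vec.span (insert b B)) = card (vec.span B) + card ((+) b ` vec.span B)"
      by (simp add: card_Un_disjoint finite_bit_vec)
    also have "\<dots> = 2 * card (vec.span B)"
      by (subst card_image) auto
    finally show ?case
      using insert.IH[OF ind] insert.hyps by simp
  qed simp
  obtain B where B: "B \<subseteq> D" "vec.independent B" "D \<subseteq> vec.span B" "card B = vec.dim D"
    using vec.basis_exists[of D] by metis
  then have "vec.span B = D"
    using assms vec.span_minimal by blast
  then show ?thesis
    using card_span[OF finite_bit_vec, of B] B by simp
qed

text \<open>
  With \<open>X d = 36 - 2 wt d\<close>, orthogonality of the coordinate characters (available because the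
  dual has minimum weight at least 3) gives \<open>\<Sum>(X\<^sup>2 - 16) = 36\<^sup>2 - 16\<close>, which is the term \<open>d = 0\<close>;
  the weight conditions make all other terms nonnegative, so they vanish.
\<close>

lemma hamming_weight_two_valued:
  fixes D :: "(bit ^ 'n::finite) set"
  assumes n: "CARD('n) = 36" and D: "vec.subspace D" "vec.dim D = 6" "doubly_even D"
    and min: "\<And>d. d \<in> D \<Longrightarrow> d \<noteq> 0 \<Longrightarrow> 16 \<le> hamming_weight d"
    and dual: "\<And>w. w \<noteq> 0 \<Longrightarrow> (\<And>d. d \<in> D \<Longrightarrow> w \<odot> d = 0) \<Longrightarrow> 3 \<le> hamming_weight w"
    and d: "d \<in> D" "d \<noteq> 0"
  shows "hamming_weight d = 16 \<or> hamming_weight d = 20"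
proof -
  \<comment> \<open>\<open>sg d i\<close> is the sign character of coordinate \<open>i\<close>;
    \<open>X d\<close> sums these signs.\<close>
  define sg :: "bit ^ 'n \<Rightarrow> 'n \<Rightarrow> int" where "sg d i = (if d $ i = 0 then 1 else -1)" for d i
  define X where "X d = (\<Sum>i\<in>UNIV. sg d i)" for d
  have bit: "k = 0 \<or> k = 1" for k :: bit
    by (metis bit_not_zero_iff)
  have X: "X d = 36 - 2 * int (hamming_weight d)" for d
  proof -
    have "X d = (\<Sum>i\<in>UNIV. 1 - 2 * of_bool (d $ i \<noteq> 0))"
      unfolding X_def sg_def by (intro sum.cong) auto
    then show ?thesis
      by (simp add: sum_subtractf n hamming_weight_def sum_of_bool_eq flip: sum_distrib_left)
  qed
  have orth: "(\<Sum>d\<in>D. sg d i * sg d j) = (if i = j then 64 else 0)" for i j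
  proof (cases "i = j")
    case True
    have "(\<Sum>d\<in>D. sg d i * sg d j) = (\<Sum>d\<in>D. 1)"
      unfolding True sg_def by (intro sum.cong) auto
    then show ?thesis
      using True card_bit_subspace[OF D(1)] D(2) by simp
  next
    case False
    \<comment> \<open>A word of weight 2 is too light for the dual, so some \<open>e\<close> in
      \<open>D\<close> differs at \<open>i\<close> and \<open>j\<close>. Translation by
      \<open>e\<close> permutes \<open>D\<close> and negates every summand, hence the sum
      vanishes.\<close>
    define w :: "bit ^ 'n" where "w = axis i 1 + axis j 1"
    have "w $ i \<noteq> 0"
      using False by (simp add: w_def axis_def)
    then have "w \<noteq> 0" by auto
    moreover have "hamming_weight w < 3"
    proof -
      have "{k. w $ k \<noteq> 0} \<subseteq> {i, j}"
        by (auto simp: w_def axis_def split: if_splits)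
      then have "hamming_weight w \<le> card {i, j}"
        unfolding hamming_weight_def by (intro card_mono) auto
      then show ?thesis using False by simp
    qed
    ultimately obtain e where e: "e \<in> D" "w \<odot> e \<noteq> 0"
      using dual[of w] by force
    have "w \<odot> e = e $ i + e $ j"
      unfolding vdot_commute[of w] unfolding w_def vdot_add_right vdot_axis by simp
    then have "e $ i \<noteq> e $ j"
      using e(2) by auto
    then have flip: "sg (e + d) i * sg (e + d) j = - (sg d i * sg d j)" for d
      using bit[of "e $ i"] bit[of "e $ j"] bit[of "d $ i"] bit[of "d $ j"]
      by (auto simp: sg_def)
    have "bij_betw ((+) e) D D"
    proof (rule bij_betwI[where g = "\<lambda>d. d - e"])
      show "(+) e \<in> D \<rightarrow> D" "(\<lambda>d. d - e) \<in> D \<rightarrow> D"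
        using D(1) e(1) by (auto intro: vec.subspace_add vec.subspace_diff)
    qed simp_all
    then have "(\<Sum>d\<in>D. sg d i * sg d j) = (\<Sum>d\<in>D. sg (e + d) i * sg (e + d) j)"
      by (simp add: sum.reindex_bij_betw[where g = "\<lambda>d. sg d i * sg d j"])
    also have "\<dots> = - (\<Sum>d\<in>D. sg d i * sg d j)"
      by (simp add: flip sum_negf)
    finally show ?thesis
      using False by simp
  qed
  have "(\<Sum>d\<in>D. X d * X d) = (\<Sum>d\<in>D. \<Sum>i\<in>UNIV. \<Sum>j\<in>UNIV. sg d i * sg d j)"
    by (simp add: X_def sum_product)
  also have "\<dots> = (\<Sum>i\<in>UNIV. \<Sum>d\<in>D. \<Sum>j\<in>UNIV. sg d i * sg d j)"
    by (rule sum.swap)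
  also have "\<dots> = (\<Sum>i\<in>UNIV. \<Sum>j\<in>UNIV. \<Sum>d\<in>D. sg d i * sg d j)"
    by (intro sum.cong refl) (rule sum.swap)
  also have "\<dots> = 36 * 64"
    by (simp add: orth n)
  finally have moment: "(\<Sum>d\<in>D. X d * X d - 16) = 36 * 36 - 16"
    using card_bit_subspace[OF D(1)] D(2) by (simp add: sum_subtractf)
  have ge: "0 \<le> X d * X d - 16 \<and> (X d * X d = 16 \<longrightarrow> hamming_weight d = 16 \<or> hamming_weight d = 20)"
    if "d \<in> D" "d \<noteq> 0" for d
  proof -
    have "4 dvd hamming_weight d"
      using D(3) that(1) by (simp add: doubly_even_def)
    then obtain m where m: "hamming_weight d = 4 * m" by (rule dvdE)
    \<comment> \<open>Centred at weight 16, the term becomes \<open>64 * (k * (k - 1))\<close>: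
      nonnegative for integers, and zero only for \<open>k = 0\<close> and \<open>k = 1\<close>,
      that is, weights 16 and 20.\<close>
    define k where "k = int m - 4"
    have k: "X d = 4 - 8 * k" "k \<ge> 0"
      using min[OF that] by (simp_all add: X m k_def)
    have sq: "X d * X d - 16 = 64 * (k * (k - 1))"
      by (simp add: k algebra_simps)
    have "k = 0 \<or> k * (k - 1) \<ge> 0"
      using k(2) by (cases "k = 0") simp_all
    moreover have "hamming_weight d = 16 \<or> hamming_weight d = 20" if "X d * X d = 16"
    proof -
      have "k * (k - 1) = 0" using sq that by simp
      then have "k = 0 \<or> k = 1" by simp
      then show ?thesis using m by (auto simp: k_def)
    qed
    ultimately show ?thesis using sq by auto
  qed
  have z: "0 \<in> D" using D(1) by (rule vec.subspace_0)
  have "hamming_weight (0 :: bit ^ 'n) = 0" by (simp add: hamming_weight_def)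
  then have X0: "X 0 = 36" using X[of 0] by simp
  have "(\<Sum>d\<in>D - {0}. X d * X d - 16) = 0"
    using moment sum.remove[OF finite_bit_vec z, of "\<lambda>d. X d * X d - 16"] X0 by simp
  then have "\<forall>d\<in>D - {0}. X d * X d - 16 = 0"
    by (subst (asm) sum_nonneg_eq_0_iff) (use ge finite_bit_vec in auto)
  then show ?thesis
    using ge[OF d] d by auto
qed

section \<open>Integer vectors self-dual modulo 4, with their residue and torsion codes\<close>

lemma bit_subspaceI:
  assumes "0 \<in> D" "\<And>x y. x \<in> D \<Longrightarrow> y \<in> D \<Longrightarrow> x + y \<in> D"
  shows "vec.subspace (D :: (bit ^ 'm) set)"
proof (rule vec.subspaceI)
  fix c :: bit and x assume "x \<in> D"
  then show "c *s x \<in> D"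
    using assms(1) by (cases "c = 0") auto
qed (use assms in auto)

text \<open>Each coordinate contributes \<open>k * (k - 1)\<close>; here \<open>1\<close> is the
  all-ones vector.\<close>

lemma even_vdot_self_diff_sum: "even (x \<odot> x - 1 \<odot> (x :: int ^ 'm::finite))"
proof -
  have "x \<odot> x - 1 \<odot> x = (\<Sum>i\<in>UNIV. x $ i * (x $ i - 1))"
    by (simp add: vdot_def sum_subtractf algebra_simps)
  also have "even \<dots>" by (intro dvd_sum) auto
  finally show ?thesis .
qed

text \<open>\<open>M\<close> plays the integral preimage of a self-dual code; integer products
  retain the information modulo 8 that is lost over \<open>4\<close>. Closure under addition and
  containment of all multiples of 4 follow from the one assumption.\<close>

locale self_dual_mod_4 =
  fixes M :: "(int ^ 'n::finite) set"
  assumes mem_iff: "x \<in> M \<longleftrightarrow> (\<forall>y\<in>M. 4 dvd x \<odot> y)"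
begin

definition residue :: "(bit ^ 'n) set" where
  "residue = of_int_vec ` M"

definition torsion :: "(bit ^ 'n) set" where
  "torsion = {of_int_vec x |x. 2 *s x \<in> M}"

lemma dvd_vdot: "x \<in> M \<Longrightarrow> y \<in> M \<Longrightarrow> 4 dvd x \<odot> y"
  using mem_iff by blast

lemma zero_mem: "0 \<in> M"
  and four_mem: "4 *s z \<in> M"
  and add_mem: "x \<in> M \<Longrightarrow> y \<in> M \<Longrightarrow> x + y \<in> M"
  and diff_mem: "x \<in> M \<Longrightarrow> y \<in> M \<Longrightarrow> x - y \<in> M"
  and double_mem: "x \<in> M \<Longrightarrow> 2 *s x \<in> M"
proof -
  show "0 \<in> M" "4 *s z \<in> M"
    by (simp_all add: mem_iff[of 0] mem_iff[of "4 *s z"] vdot_simps)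
  show "x \<in> M \<Longrightarrow> y \<in> M \<Longrightarrow> x + y \<in> M" "x \<in> M \<Longrightarrow> y \<in> M \<Longrightarrow> x - y \<in> M" "x \<in> M \<Longrightarrow> 2 *s x \<in> M"
    by (auto simp: mem_iff[of "x + y"] mem_iff[of "x - y"] mem_iff[of "2 *s x"] vdot_simps dvd_vdot)
qed

lemma double_mem_iff: "2 *s x \<in> M \<longleftrightarrow> (\<forall>y\<in>M. even (x \<odot> y))"
proof -
  have "4 dvd 2 * k \<longleftrightarrow> even k" for k :: int by presburger
  then show ?thesis by (simp add: mem_iff[of "2 *s x"] vdot_simps)
qed

text \<open>\<open>4 dvd 2 * k\<close> means that \<open>k\<close> is even, so self-duality modulo 4
  turns into orthogonality to the residue words modulo 2.\<close>

lemma torsion_dual: "t \<in> torsion \<longleftrightarrow> (\<forall>r\<in>residue. t \<odot> r = 0)"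
proof -
  have *: "2 *s x \<in> M \<longleftrightarrow> (\<forall>r\<in>residue. of_int_vec x \<odot> r = 0)" for x
    by (simp add: double_mem_iff residue_def vdot_of_int_vec of_int_bit_eq_0_iff)
  show ?thesis
  proof
    assume "\<forall>r\<in>residue. t \<odot> r = 0"
    then have "2 *s bit_lift t \<in> M"
      using *[of "bit_lift t"] by simp
    then show "t \<in> torsion"
      unfolding torsion_def by (auto intro!: exI[of _ "bit_lift t"])
  qed (auto simp: torsion_def *)
qed

text \<open>Whether \<open>2 *s x\<close> lies in \<open>M\<close> depends only on \<open>x\<close>
  modulo 2, so any lift of a torsion word may be used.\<close>

lemma of_int_vec_mem_torsion_iff: "of_int_vec x \<in> torsion \<longleftrightarrow> 2 *s x \<in> M"
  by (simp add: torsion_dual double_mem_iff residue_def vdot_of_int_vec of_int_bit_eq_0_iff)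

lemma subspace_residue: "vec.subspace residue"
proof (rule bit_subspaceI)
  show "0 \<in> residue"
    unfolding residue_def using zero_mem of_int_vec_0 by force
  show "x + y \<in> residue" if "x \<in> residue" "y \<in> residue" for x y
    using that add_mem unfolding residue_def by (auto simp flip: of_int_vec_add)
qed

lemma subspace_torsion: "vec.subspace torsion"
  by (rule bit_subspaceI) (simp_all add: torsion_dual vdot_simps)

text \<open>A word outside \<open>residue\<close> is separated from it by some \<open>w\<close>;
  this \<open>w\<close> is a torsion word, contradicting orthogonality.\<close>

lemma residue_dual: "r \<in> residue \<longleftrightarrow> (\<forall>t\<in>torsion. r \<odot> t = 0)"
proof
  assume r: "\<forall>t\<in>torsion. r \<odot> t = 0"
  show "r \<in> residue"
  proof (rule ccontr)
    assume "r \<notin> residue"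
    then obtain w where w: "\<And>d. d \<in> residue \<Longrightarrow> w \<odot> d = 0" "w \<odot> r = 1"
      using subspace_separation[OF subspace_residue] by metis
    then show False
      using r torsion_dual[of w] vdot_commute[of r w] by simp
  qed
qed (auto simp: torsion_dual vdot_commute)

section \<open>Characteristic vectors and the shadow coset\<close>

text \<open>
  The map \<open>f x / 4 mod 2\<close> below is additive on \<open>M\<close> and depends only on the residue of \<open>x\<close>, so it is
  the inner product with a binary vector \<open>u\<close>; then \<open>1 + 2 u\<close> is characteristic.
\<close>

lemma exists_odd_characteristic:
  obtains z where "\<And>i. odd (z $ i)" "\<And>x. x \<in> M \<Longrightarrow> 8 dvd x \<odot> x - 2 * (z \<odot> x)"
proof -
  \<comment> \<open>The defect of the all-ones vector as a characteristic vector.\<close>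
  define f where "f x = x \<odot> x - 2 * (1 \<odot> x)" for x :: "int ^ 'n"
  have f4: "4 dvd f x" if "x \<in> M" for x
    using dvd_vdot[OF that that] even_vdot_self_diff_sum[of x] unfolding f_def by presburger
  have f_add: "f (x + y) = f x + f y + 2 * (x \<odot> y)"
    and f_diff: "f (x - y) = f x + f y - 2 * (x \<odot> y) + 4 * (1 \<odot> y)" for x y
    by (simp_all add: f_def vdot_simps vdot_commute[of y x])
  have f_double: "8 dvd f (2 *s t)" for t
  proof -
    have "f (2 *s t) = 4 * (t \<odot> t - 1 \<odot> t)" by (simp add: f_def vdot_simps)
    then show ?thesis using even_vdot_self_diff_sum[of t] by presburger
  qed
  \<comment> \<open>The kernel of \<open>f / 4\<close> modulo 2 on \<open>M\<close>.\<close>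
  define K where "K = {x \<in> M. 8 dvd f x}"
  define D :: "(bit ^ 'n) set" where "D = of_int_vec ` K"
  have D: "vec.subspace D"
  proof (rule bit_subspaceI)
    have "0 \<in> K" using zero_mem by (simp add: K_def f_def vdot_simps)
    then show "0 \<in> D" unfolding D_def using of_int_vec_0 by force
    have "x + y \<in> K" if "x \<in> K" "y \<in> K" for x y
    proof -
      have "8 dvd 2 * (x \<odot> y)" using dvd_vdot[of x y] that by (auto simp: K_def)
      then show ?thesis using that add_mem by (auto simp: K_def f_add)
    qed
    then show "x + y \<in> D" if "x \<in> D" "y \<in> D" for x y
      using that by (auto simp: D_def simp flip: of_int_vec_add)
  qed
  \<comment> \<open>The error consists of \<open>2 * f y\<close>, the cross term and
    \<open>4 * (1 \<odot> y)\<close>. Each is divisible by 8 on \<open>M\<close>, since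
    \<open>1 \<odot> y\<close> has the parity of \<open>y \<odot> y\<close>.\<close>
  have diff: "8 dvd f (x - y) - (f x - f y)" if "x \<in> M" "y \<in> M" for x y
  proof -
    have "f (x - y) - (f x - f y) = 2 * f y - 2 * (x \<odot> y) + 4 * (1 \<odot> y)"
      by (simp add: f_diff)
    moreover have "even (1 \<odot> y)"
      using dvd_vdot[OF that(2) that(2)] even_vdot_self_diff_sum[of y] by presburger
    ultimately show ?thesis
      using f4[OF that(2)] dvd_vdot[OF that] by presburger
  qed
  have "\<exists>u. \<forall>x\<in>M. 8 dvd f x - 4 * (u \<odot> x)"
  proof (cases "M \<subseteq> K")
    case True
    then show ?thesis by (intro exI[of _ 0]) (auto simp: K_def vdot_simps)
  next
    case False
    then obtain x0 where x0: "x0 \<in> M" "x0 \<notin> K" by auto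
    \<comment> \<open>Vectors with the same residue differ by some \<open>2 *s t\<close>, where
      \<open>f\<close> vanishes modulo 8; so \<open>x0\<close> would lie in
      \<open>K\<close>.\<close>
    have "of_int_vec x0 \<notin> D"
    proof
      assume "of_int_vec x0 \<in> D"
      then obtain k where k: "k \<in> K" "(of_int_vec x0 :: bit ^ 'n) = of_int_vec k"
        by (auto simp: D_def)
      then obtain t where t: "x0 - k = 2 *s t"
        by (auto simp: of_int_vec_bit_eq_iff)
      have "8 dvd f x0"
      proof -
        have "k \<in> M" "8 dvd f k" using k(1) by (simp_all add: K_def)
        then show ?thesis
          using diff[OF x0(1) \<open>k \<in> M\<close>] f_double[of t] unfolding t by presburger
      qed
      then show False using x0 by (simp add: K_def)
    qed
    then obtain w where w: "\<And>d. d \<in> D \<Longrightarrow> w \<odot> d = 0" "w \<odot> of_int_vec x0 = 1"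
      using subspace_separation[OF D] by metis
    define u where "u = bit_lift w"
    have w_eq: "w \<odot> of_int_vec x = of_int (u \<odot> x)" for x
      using vdot_of_int_vec[of u x, where 'a = bit] by (simp add: u_def)
    have uK: "even (u \<odot> x)" if "x \<in> K" for x
      using w(1)[of "of_int_vec x"] that by (auto simp: D_def w_eq of_int_bit_eq_0_iff)
    have u0: "odd (u \<odot> x0)"
      using w(2) by (metis of_int_bit_eq_0_iff w_eq zero_neq_one)
    \<comment> \<open>\<open>M\<close> consists of \<open>K\<close>, where \<open>u\<close> has even
      product, and the coset of \<open>x0\<close>, where the product is odd; \<open>f / 4\<close>
      has the same parities.\<close>
    have "8 dvd f x - 4 * (u \<odot> x)" if x: "x \<in> M" for x
    proof (cases "x \<in> K")
      case True
      then show ?thesis using uK[OF True] by (auto simp: K_def)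
    next
      case False
      have "\<not> 8 dvd f x" "\<not> 8 dvd f x0"
        using x x0 False by (simp_all add: K_def)
      then have fx: "f x mod 8 = 4" "f x0 mod 8 = 4"
        using f4[OF x] f4[OF x0(1)] by presburger+
      then have "8 dvd f (x - x0)"
        using diff[OF x x0(1)] by presburger
      then have "x - x0 \<in> K" using x x0 diff_mem by (simp add: K_def)
      then have "odd (u \<odot> x)" using uK[of "x - x0"] u0 by (simp add: vdot_simps)
      then show ?thesis using fx by presburger
    qed
    then show ?thesis by blast
  qed
  then obtain u where u: "\<forall>x\<in>M. 8 dvd f x - 4 * (u \<odot> x)" by blast
  show ?thesis
  proof (rule that[of "1 + 2 *s u"])
    show "8 dvd x \<odot> x - 2 * ((1 + 2 *s u) \<odot> x)" if "x \<in> M" for x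
    proof -
      have "x \<odot> x - 2 * ((1 + 2 *s u) \<odot> x) = f x - 4 * (u \<odot> x)"
        by (simp add: f_def vdot_simps)
      then show ?thesis using u that by simp
    qed
  qed simp
qed

text \<open>Modulo 4, products with \<open>z\<close> vanish on the index-2 subgroup of
  \<open>M\<close> where 8 divides the squared length, but not on all of \<open>M\<close>. They must
  be 2 off that subgroup, as are those with \<open>z0\<close>; hence \<open>z - z0\<close> is
  orthogonal to \<open>M\<close> modulo 4. The vector \<open>x1\<close> witnesses that the lattice
  is odd.\<close>

lemma shadow_coset:
  assumes z0: "\<And>x. x \<in> M \<Longrightarrow> 8 dvd x \<odot> x - 2 * (z0 \<odot> x)"
    and x1: "x1 \<in> M" "\<not> 8 dvd x1 \<odot> x1"
  shows "(\<forall>y\<in>M. 8 dvd y \<odot> y \<longrightarrow> 4 dvd z \<odot> y) \<and> z \<notin> M \<longleftrightarrow> z - z0 \<in> M" (is "?L \<longleftrightarrow> _")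
proof
  assume L: ?L
  have L0: "4 dvd z \<odot> y" if "y \<in> M" "8 dvd y \<odot> y" for y
    by (rule L[THEN conjunct1, rule_format, OF that])
  have M4: "(y \<odot> y) mod 8 = 4" if "y \<in> M" "\<not> 8 dvd y \<odot> y" for y
    using dvd_vdot[OF that(1) that(1)] that(2) by presburger
  \<comment> \<open>The double of \<open>x1\<close> lies in the subgroup, which forces
    \<open>z \<odot> x1\<close> to be even.\<close>
  have "8 dvd (2 *s x1) \<odot> (2 *s x1)"
    using dvd_vdot[OF x1(1) x1(1)] unfolding vdot_simps by presburger
  then have zx1: "even (z \<odot> x1)"
  proof -
    have "4 dvd 2 * (z \<odot> x1)"
      using L0[OF double_mem[OF x1(1)] \<open>8 dvd (2 *s x1) \<odot> (2 *s x1)\<close>]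
      by (simp only: vdot_scale_right)
    then show ?thesis by presburger
  qed
  \<comment> \<open>Two vectors outside the index-2 subgroup differ by a member of it.\<close>
  have same: "4 dvd z \<odot> y - z \<odot> x1" if y: "y \<in> M" "\<not> 8 dvd y \<odot> y" for y
  proof -
    have "(y - x1) \<odot> (y - x1) = y \<odot> y + x1 \<odot> x1 - 2 * (y \<odot> x1)"
      by (simp add: vdot_simps vdot_commute[of x1 y])
    then have "8 dvd (y - x1) \<odot> (y - x1)"
      using M4[OF y] M4[OF x1] dvd_vdot[OF y(1) x1(1)] by presburger
    then have "4 dvd z \<odot> (y - x1)"
      by (rule L0[OF diff_mem[OF y(1) x1(1)]])
    then show ?thesis
      by (simp only: vdot_diff_right)
  qed
  have "\<not> 4 dvd z \<odot> x1"
  proof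
    assume "4 dvd z \<odot> x1"
    have "4 dvd z \<odot> y" if "y \<in> M" for y
    proof (cases "8 dvd y \<odot> y")
      case False
      then show ?thesis using same[OF that False] \<open>4 dvd z \<odot> x1\<close> by presburger
    qed (rule L0[OF that])
    then have "z \<in> M" by (simp only: mem_iff[of z]) simp
    then show False using L by simp
  qed
  have "4 dvd (z - z0) \<odot> y" if "y \<in> M" for y
  proof (cases "8 dvd y \<odot> y")
    case True
    then show ?thesis
      using L0[OF that True] z0[OF that] unfolding vdot_diff_left by presburger
  next
    case False
    have "(z \<odot> x1) mod 4 = 2"
      using zx1 \<open>\<not> 4 dvd z \<odot> x1\<close> by presburger
    then have "(z \<odot> y) mod 4 = 2"
      using same[OF that False] by presburger
    moreover have "(z0 \<odot> y) mod 4 = 2"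
      using M4[OF that False] z0[OF that] by presburger
    ultimately show ?thesis
      unfolding vdot_diff_left by presburger
  qed
  then show "z - z0 \<in> M" unfolding mem_iff[of "z - z0"] by simp
next
  assume R: "z - z0 \<in> M"
  have "4 dvd z \<odot> y" if "y \<in> M" "8 dvd y \<odot> y" for y
    using dvd_vdot[OF R that(1)] z0[OF that(1)] that(2)
    unfolding vdot_diff_left by presburger
  \<comment> \<open>Otherwise \<open>z0\<close> lies in \<open>M\<close>, so 4 divides
    \<open>z0 \<odot> x1\<close> and 8 divides \<open>x1 \<odot> x1\<close>.\<close>
  moreover have "z \<notin> M"
  proof
    assume "z \<in> M"
    then have "z0 \<in> M" using diff_mem[OF _ R, of z] by simp
    then show False using dvd_vdot[OF \<open>z0 \<in> M\<close> x1(1)] z0[OF x1(1)] x1(2) by presburger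
  qed
  ultimately show ?L by blast
qed

end

section \<open>Small representatives and halved integer vectors\<close>

lemma exists_vec_mod_4_small: "\<exists>r s. r = v + 4 *s s \<and> (\<forall>i. r $ i \<in> {-1, 0, 1, 2 :: int})"
proof -
  have "((v $ i + 1) mod 4 - 1) \<in> {-1, 0, 1, 2}" for i
  proof -
    have "(v $ i + 1) mod 4 \<in> {0..<4}" by simp
    then show ?thesis by auto
  qed
  moreover have "(v $ i + 1) mod 4 - 1 = v $ i + 4 * (- ((v $ i + 1) div 4))" for i
    using mult_div_mod_eq[of 4 "v $ i + 1"] by linarith
  ultimately show ?thesis
    by (intro exI[of _ "\<chi> i. (v $ i + 1) mod 4 - 1"] exI[of _ "\<chi> i. - ((v $ i + 1) div 4)"])
      (simp add: vec_eq_iff)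
qed

lemma card_odd_coset:
  fixes x z :: "int ^ 'n::finite"
  assumes "\<And>i. odd (z $ i)"
  shows "card {i. odd ((z + x) $ i)} = CARD('n) - hamming_weight (of_int_vec x)"
proof -
  have "{i. odd ((z + x) $ i)} = UNIV - {i. odd (x $ i)}"
    using assms by auto
  then show ?thesis
    by (simp add: hamming_weight_of_int_vec card_Diff_subset)
qed

text \<open>Halving divides inner products by 4, so orthogonality modulo 4 becomes
  integrality.\<close>

definition half_vec :: "int ^ 'n::finite \<Rightarrow> real ^ 'n" where
  "half_vec x = (1 / 2) *\<^sub>R of_int_vec x"

lemma half_vec_nth [simp]: "half_vec x $ i = of_int (x $ i) / 2"
  by (simp add: half_vec_def)

lemma half_vec_diff: "half_vec (x - y) = half_vec x - half_vec y"
  by (simp add: vec_eq_iff field_simps)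

lemma half_vec_inject: "half_vec x = half_vec y \<longleftrightarrow> x = y"
  by (simp add: vec_eq_iff)

lemma inner_half_vec: "half_vec x \<bullet> half_vec y = of_int (x \<odot> y) / 4"
  by (simp add: inner_vec_def vdot_def sum_divide_distrib)

lemma of_int_divide_4_in_Ints: "of_int k / (4 :: real) \<in> \<int> \<longleftrightarrow> 4 dvd k"
proof
  assume "of_int k / (4 :: real) \<in> \<int>"
  then obtain j where "of_int k / (4 :: real) = of_int j" by (rule Ints_cases)
  then have "(of_int k :: real) = of_int (4 * j)" by simp
  then have "k = 4 * j" by (simp only: of_int_eq_iff)
  then show "4 dvd k" by simp
qed (auto elim!: dvdE)

lemma inner_half_vec_in_Ints: "half_vec x \<bullet> half_vec y \<in> \<int> \<longleftrightarrow> 4 dvd x \<odot> y"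
  by (simp add: inner_half_vec of_int_divide_4_in_Ints)

text \<open>The test vector is twice a unit vector, so \<open>2 * s $ i\<close> is an integer. This
  confines dual lattices to halved integer vectors.\<close>

lemma exists_half_vec:
  assumes "\<And>i. s \<bullet> half_vec (4 *s axis i 1) \<in> \<int>"
  obtains z where "s = half_vec z"
proof -
  have "\<exists>k. s $ i = of_int k / 2" for i
  proof -
    have "half_vec (4 *s axis i 1) = axis i 2"
      by (simp add: vec_eq_iff axis_def)
    then have "s $ i * 2 \<in> \<int>"
      using assms[of i] by (simp add: inner_axis)
    then obtain k where "s $ i * 2 = of_int k" by (rule Ints_cases)
    then show ?thesis by (intro exI[of _ k]) simp
  qed
  then obtain f where "\<And>i. s $ i = of_int (f i) / 2" by metis
  then have "s = half_vec (vec_lambda f)" by (simp add: vec_eq_iff)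
  then show ?thesis by (rule that)
qed

context self_dual_mod_4
begin

text \<open>Distinct points differ by at least 1/2 in some coordinate, giving discreteness; the
  doubled unit vectors give full rank; \<open>mem_iff\<close> gives self-duality.\<close>

lemma unimodular_half_vec: "unimodular (half_vec ` M)"
proof -
  let ?L = "half_vec ` M"
  have "0 = half_vec 0" by (simp add: vec_eq_iff)
  then have "0 \<in> ?L" using zero_mem by blast
  moreover have "\<forall>x\<in>?L. \<forall>y\<in>?L. x - y \<in> ?L"
    using diff_mem by (auto simp flip: half_vec_diff)
  moreover have "discrete ?L"
  proof (rule uniform_discrete_imp_discrete)
    have "x = y" if "dist (half_vec x) (half_vec y) < 1 / 2" for x y :: "int ^ 'n"
    proof -
      have "(x - y) $ i = 0" for i
      proof -
        have small: "k = 0" if "\<bar>of_int k / 2 :: real\<bar> < 1 / 2" for k :: int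
          using that by simp
        have "(half_vec x - half_vec y) $ i = of_int ((x - y) $ i) / 2"
          by (simp add: diff_divide_distrib)
        then show ?thesis
          using that component_le_norm_cart[of "half_vec x - half_vec y" i]
          by (intro small) (simp only: dist_norm)
      qed
      then show ?thesis by (simp add: vec_eq_iff)
    qed
    then show "uniform_discrete ?L"
      unfolding uniform_discrete_def by (intro exI[of _ "1 / 2"]) force
  qed
  moreover have "span ?L = UNIV"
  proof -
    have "b \<in> span ?L" if "b \<in> Basis" for b :: "real ^ 'n"
    proof -
      obtain i where "b = axis i 1" using \<open>b \<in> Basis\<close> by (auto simp: Basis_vec_def)
      then have "b = (1 / 2) *\<^sub>R half_vec (4 *s axis i 1)"
        by (simp add: vec_eq_iff axis_def)
      then show ?thesis using four_mem span_base span_scale by (metis imageI)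
    qed
    then have "span Basis \<subseteq> span ?L"
      by (intro span_minimal) auto
    then show ?thesis by auto
  qed
  moreover have "?L = dual_lattice ?L"
  proof
    show "?L \<subseteq> dual_lattice ?L"
      by (auto simp: dual_lattice_def inner_half_vec_in_Ints dvd_vdot)
    show "dual_lattice ?L \<subseteq> ?L"
    proof
      fix s assume s: "s \<in> dual_lattice ?L"
      then obtain z where z: "s = half_vec z"
        using exists_half_vec[of s] four_mem by (auto simp: dual_lattice_def)
      have "z \<in> M"
        using s unfolding z by (subst mem_iff) (simp add: dual_lattice_def inner_half_vec_in_Ints)
      then show "s \<in> ?L" using z by simp
    qed
  qed
  ultimately show ?thesis
    unfolding unimodular_def full_lattice_def by blast
qed

lemma half_vec_mem_iff: "half_vec z \<in> half_vec ` M \<longleftrightarrow> z \<in> M"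
  by (auto simp: half_vec_inject)

lemma even_sublattice_half_vec: "even_sublattice (half_vec ` M) = half_vec ` {x \<in> M. 8 dvd x \<odot> x}"
proof -
  have "(\<exists>k::int. half_vec x \<bullet> half_vec x = 2 * of_int k) \<longleftrightarrow> 8 dvd x \<odot> x" for x :: "int ^ 'n"
  proof -
    have "half_vec x \<bullet> half_vec x = 2 * of_int k \<longleftrightarrow> x \<odot> x = 8 * k" for k
    proof -
      have "half_vec x \<bullet> half_vec x = 2 * of_int k \<longleftrightarrow> real_of_int (x \<odot> x) = of_int (8 * k)"
        unfolding inner_half_vec by auto
      then show ?thesis by (simp only: of_int_eq_iff)
    qed
    then show ?thesis by (simp add: dvd_def)
  qed
  then show ?thesis by (auto simp: even_sublattice_def)
qed

text \<open>The vectors \<open>4 *s axis i 1\<close> have squared length 16 and so enter the even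
  sublattice after halving. Its dual therefore contains only halved integer vectors, to which
  \<open>shadow_coset\<close> applies.\<close>

lemma shadow_half_vec:
  assumes z0: "\<And>x. x \<in> M \<Longrightarrow> 8 dvd x \<odot> x - 2 * (z0 \<odot> x)"
    and x1: "x1 \<in> M" "\<not> 8 dvd x1 \<odot> x1"
  shows "shadow (half_vec ` M) = half_vec ` {z. z - z0 \<in> M}"
proof -
  let ?E = "even_sublattice (half_vec ` M)"
  have dual: "half_vec z \<in> dual_lattice ?E \<longleftrightarrow> (\<forall>y\<in>M. 8 dvd y \<odot> y \<longrightarrow> 4 dvd z \<odot> y)" for z
    by (auto simp: dual_lattice_def even_sublattice_half_vec inner_half_vec_in_Ints)
  have coset: "half_vec z \<in> shadow (half_vec ` M) \<longleftrightarrow> z - z0 \<in> M" for z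
    unfolding shadow_def Diff_iff dual half_vec_mem_iff by (rule shadow_coset[OF z0 x1])
  have "s \<in> half_vec ` {z. z - z0 \<in> M}" if s: "s \<in> shadow (half_vec ` M)" for s
  proof -
    have "8 dvd (4 *s axis i 1) \<odot> (4 *s axis i (1::int))" for i :: 'n
      by (simp add: vdot_simps)
    then have "half_vec (4 *s axis i 1) \<in> ?E" for i :: 'n
      using four_mem unfolding even_sublattice_half_vec by (intro imageI) simp
    moreover have "\<forall>y\<in>?E. s \<bullet> y \<in> \<int>"
      using s unfolding shadow_def dual_lattice_def by simp
    ultimately have "s \<bullet> half_vec (4 *s axis i 1) \<in> \<int>" for i
      by simp
    then obtain z where "s = half_vec z" by (rule exists_half_vec)
    then show ?thesis using s coset[of z] by simp
  qed
  moreover have "half_vec ` {z. z - z0 \<in> M} \<subseteq> shadow (half_vec ` M)"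
    using coset by auto
  ultimately show ?thesis by blast
qed

section \<open>Squared lengths in the lattice and in its shadow\<close>

text \<open>A nonzero residue gives at least 12 odd entries. Otherwise \<open>x = 2 *s t\<close>: a
  nonzero torsion word gives at least 4 times 3, and \<open>x = 4 *s s\<close> gives at least
  16.\<close>

lemma vdot_self_ge_12:
  assumes residue: "\<And>r. r \<in> residue \<Longrightarrow> r \<noteq> 0 \<Longrightarrow> 12 \<le> hamming_weight r"
    and torsion: "\<And>t. t \<in> torsion \<Longrightarrow> t \<noteq> 0 \<Longrightarrow> 3 \<le> hamming_weight t"
    and x: "x \<in> M" "x \<noteq> 0"
  shows "12 \<le> x \<odot> x"
proof (cases "(of_int_vec x :: bit ^ 'n) = 0")
  case False
  have "(of_int_vec x :: bit ^ 'n) \<in> residue" using x(1) by (simp add: residue_def)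
  from residue[OF this False] hamming_weight_le_vdot_self[of x] show ?thesis by linarith
next
  case True
  then have "(of_int_vec x :: bit ^ 'n) = of_int_vec 0" by (simp add: of_int_vec_0)
  then obtain t where t: "x = 2 *s t" unfolding of_int_vec_bit_eq_iff by auto
  have xt: "x \<odot> x = 4 * (t \<odot> t)" by (simp add: t vdot_simps)
  show ?thesis
  proof (cases "(of_int_vec t :: bit ^ 'n) = 0")
    case False
    have "(of_int_vec t :: bit ^ 'n) \<in> torsion"
      using x(1) t by (simp add: of_int_vec_mem_torsion_iff)
    from torsion[OF this False] hamming_weight_le_vdot_self[of t] xt show ?thesis by linarith
  next
    case True
    then have "(of_int_vec t :: bit ^ 'n) = of_int_vec 0" by (simp add: of_int_vec_0)
    then obtain s where s: "t = 2 *s s" unfolding of_int_vec_bit_eq_iff by auto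
    have "s \<noteq> 0" using x(2) t s by (auto simp: vec_eq_iff)
    then have "{i. s $ i \<noteq> 0} \<noteq> {}" by (auto simp: vec_eq_iff)
    then have "1 \<le> card {i. s $ i \<noteq> 0}" by (simp add: Suc_le_eq card_gt_0_iff)
    then have "1 \<le> s \<odot> s" using vdot_self_ge_card_nonzero[of s] by linarith
    moreover have "x \<odot> x = 16 * (s \<odot> s)" by (simp add: xt s vdot_simps)
    ultimately show ?thesis by linarith
  qed
qed

text \<open>Odd squares are 1 modulo 8, which settles \<open>z\<close> itself. Adding
  \<open>x\<close> contributes \<open>2 * (x \<odot> x)\<close> minus the characteristic expression,
  both divisible by 8.\<close>

lemma characteristic_vdot_self_cong_8:
  assumes "\<And>i. odd (z $ i)" "\<And>x. x \<in> M \<Longrightarrow> 8 dvd x \<odot> x - 2 * (z \<odot> x)" "x \<in> M"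
  shows "[(z + x) \<odot> (z + x) = int CARD('n)] (mod 8)"
proof -
  have "z $ i mod 4 \<noteq> 2" for i using assms(1)[of i] by presburger
  then have "{i. z $ i mod 4 = 2} = {}" by simp
  then have zz: "[z \<odot> z = int CARD('n)] (mod 8)"
    using vdot_self_cong_8[of z] assms(1) by simp
  have "(z + x) \<odot> (z + x) - z \<odot> z = 2 * (x \<odot> x) - (x \<odot> x - 2 * (z \<odot> x))"
    by (simp add: vdot_simps vdot_commute[of x z])
  moreover have "8 dvd 2 * (x \<odot> x)"
    using dvd_vdot[OF assms(3) assms(3)] by presburger
  ultimately have "8 dvd (z + x) \<odot> (z + x) - z \<odot> z"
    using assms(2)[OF assms(3)] by (metis dvd_diff)
  then have "[(z + x) \<odot> (z + x) = z \<odot> z] (mod 8)" by (simp add: cong_iff_dvd_diff)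
  with zz show ?thesis using cong_trans by blast
qed

text \<open>
  A vector orthogonal to all torsion words and supported in the support of the minimal word \<open>c\<close>
  is a residue word, hence \<open>0\<close> or \<open>c\<close>, and both are orthogonal to \<open>b\<close>.
\<close>

lemma torsion_onto_even_weight:
  assumes c: "c \<in> residue" "\<And>r. r \<in> residue \<Longrightarrow> r \<noteq> 0 \<Longrightarrow> hamming_weight c \<le> hamming_weight r"
    and b: "even (hamming_weight b)" "\<And>i. c $ i = 0 \<Longrightarrow> b $ i = 0"
  obtains t where "t \<in> torsion" "\<And>i. c $ i \<noteq> 0 \<Longrightarrow> t $ i = b $ i"
proof -
  define D where "D = {d :: bit ^ 'n. \<exists>t\<in>torsion. \<forall>i. c $ i \<noteq> 0 \<longrightarrow> t $ i = d $ i}"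
  have torsion_le: "t \<in> D" if "t \<in> torsion" for t
    using that unfolding D_def by blast
  have D: "vec.subspace D"
  proof (rule bit_subspaceI)
    show "0 \<in> D" by (rule torsion_le) (rule vec.subspace_0[OF subspace_torsion])
    show "x + y \<in> D" if "x \<in> D" "y \<in> D" for x y
    proof -
      from that obtain s t where "s \<in> torsion" "t \<in> torsion"
        "\<forall>i. c $ i \<noteq> 0 \<longrightarrow> s $ i = x $ i" "\<forall>i. c $ i \<noteq> 0 \<longrightarrow> t $ i = y $ i"
        by (auto simp: D_def)
      then show ?thesis
        unfolding D_def
        by (intro CollectI bexI[of _ "s + t"]) (auto intro: vec.subspace_add[OF subspace_torsion])
    qed
  qed
  have "b \<in> D"
  proof (rule ccontr)
    assume "b \<notin> D"
    then obtain w where w: "\<And>d. d \<in> D \<Longrightarrow> w \<odot> d = 0" "w \<odot> b = 1"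
      using subspace_separation[OF D] by metis
    have "w \<in> residue"
      unfolding residue_dual using w(1)[OF torsion_le] by simp
    moreover have "w \<noteq> 0" using w(2) by (auto simp: vdot_simps)
    ultimately have le: "hamming_weight c \<le> hamming_weight w" by (rule c(2))
    have sub: "{i. w $ i \<noteq> 0} \<subseteq> {i. c $ i \<noteq> 0}"
    proof
      fix i assume i: "i \<in> {i. w $ i \<noteq> 0}"
      show "i \<in> {i. c $ i \<noteq> 0}"
      proof (rule ccontr)
        assume "i \<notin> {i. c $ i \<noteq> 0}"
        \<comment> \<open>A unit vector off the support of \<open>c\<close> agrees there with the
          zero word.\<close>
        then have "axis i 1 \<in> D"
          unfolding D_def using vec.subspace_0[OF subspace_torsion]
          by (intro CollectI bexI[of _ 0]) (auto simp: axis_def)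
        then have "w $ i = 0" using w(1)[of "axis i 1"] by simp
        then show False using i by simp
      qed
    qed
    then have eq: "{i. w $ i \<noteq> 0} = {i. c $ i \<noteq> 0}"
      using le unfolding hamming_weight_def by (intro card_seteq) auto
    \<comment> \<open>\<open>w\<close> has the support of \<open>c\<close>, which contains that of
      \<open>b\<close>, so this product is the weight of \<open>b\<close> modulo 2.\<close>
    have "w \<odot> b = (\<Sum>i\<in>UNIV. of_bool (b $ i \<noteq> 0))"
      unfolding vdot_def
    proof (intro sum.cong refl)
      fix i
      have "w $ i \<noteq> 0" if "b $ i \<noteq> 0"
        using b(2)[of i] that eq by blast
      then show "w $ i * b $ i = of_bool (b $ i \<noteq> 0)"
        by (cases "b $ i = 0") simp_all
    qed
    also have "\<dots> = of_nat (hamming_weight b)"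
      by (simp add: sum_of_bool_eq hamming_weight_def)
    also have "\<dots> = 0"
      using b(1) of_int_bit_eq_0_iff[of "int (hamming_weight b)"] by simp
    finally show False using w(2) by simp
  qed
  then obtain t where "t \<in> torsion" "\<forall>i. c $ i \<noteq> 0 \<longrightarrow> t $ i = b $ i"
    unfolding D_def by blast
  then show ?thesis by (intro that[of t]) simp_all
qed

text \<open>Adding a preimage of \<open>c\<close> to \<open>z\<close> makes exactly the entries on
  the support of \<open>c\<close> even. A torsion word makes these divisible by 4, and reduction
  modulo 4 leaves zeros there and units elsewhere.\<close>

lemma characteristic_attained:
  assumes z: "\<And>i. odd (z $ i)" "\<And>x. x \<in> M \<Longrightarrow> 8 dvd x \<odot> x - 2 * (z \<odot> x)"
    and c: "c \<in> residue" "\<And>r. r \<in> residue \<Longrightarrow> r \<noteq> 0 \<Longrightarrow> hamming_weight c \<le> hamming_weight r"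
      "8 dvd hamming_weight c"
  shows "\<exists>v. v - z \<in> M \<and> v \<odot> v = int (CARD('n) - hamming_weight c)"
proof -
  obtain x where x: "x \<in> M" "c = of_int_vec x" using c(1) by (auto simp: residue_def)
  define u where "u = z + x"
  have c0: "c $ i = 0 \<longleftrightarrow> odd (u $ i)" for i
    using z(1)[of i] by (simp add: x(2) u_def of_int_bit_eq_0_iff)
  define b :: "bit ^ 'n" where "b = (\<chi> i. of_bool (u $ i mod 4 = 2))"
  have "hamming_weight c \<le> CARD('n)"
    unfolding hamming_weight_def by (intro card_mono) auto
  then have card: "int (CARD('n) - hamming_weight c) = int CARD('n) - int (hamming_weight c)"
    by simp
  \<comment> \<open>Two evaluations of \<open>u \<odot> u\<close>: as a characteristic vector, and
    by counting its odd entries and those equal to 2 modulo 4. Since 8 divides the weight of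
    \<open>c\<close>, the weight of \<open>b\<close> is even.\<close>
  have "[int CARD('n) = int (CARD('n) - hamming_weight c) + 4 * int (hamming_weight b)] (mod 8)"
    using characteristic_vdot_self_cong_8[OF z x(1)] vdot_self_cong_8[of u]
    by (simp add: u_def[symmetric] card_odd_coset[OF z(1), of x, folded u_def] x(2) b_def
        hamming_weight_def[of "vec_lambda _"]) (metis cong_sym cong_trans)
  then have "8 dvd int (hamming_weight c) - 4 * int (hamming_weight b)"
    unfolding card cong_iff_dvd_diff by (simp add: algebra_simps)
  moreover have "8 dvd int (hamming_weight c)" using c(3) by presburger
  ultimately have "even (hamming_weight b)" by presburger
  moreover have "b $ i = 0" if "c $ i = 0" for i
  proof -
    have "odd (u $ i)" using that c0 by simp
    then have "u $ i mod 4 \<noteq> 2" by presburger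
    then show ?thesis by (simp add: b_def)
  qed
  ultimately obtain t where t: "t \<in> torsion" "\<And>i. c $ i \<noteq> 0 \<Longrightarrow> t $ i = b $ i"
    using torsion_onto_even_weight[OF c(1,2)] by metis
  define T where "T = bit_lift t"
  have T: "2 *s T \<in> M"
    using t(1) by (simp add: T_def flip: of_int_vec_mem_torsion_iff)
  \<comment> \<open>In this range an odd entry is 1 or -1 and a multiple of 4 is 0.\<close>
  obtain v s where v: "v = u + 2 *s T + 4 *s s" "\<forall>i. v $ i \<in> {-1, 0, 1, 2}"
    using exists_vec_mod_4_small by metis
  have "v - z = x + 2 *s T + 4 *s s" by (simp add: v(1) u_def)
  then have "v - z \<in> M" using add_mem x(1) T four_mem by simp
  moreover have "v \<odot> v = int (CARD('n) - hamming_weight c)"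
  proof -
    have "v $ i * v $ i = of_bool (odd (u $ i))" for i
    proof (cases "odd (u $ i)")
      case True
      then have "odd (v $ i)" by (simp add: v(1))
      then show ?thesis using True v(2)[rule_format, of i] by auto
    next
      case False
      then have "t $ i = b $ i" using t(2) c0 by blast
      then have "T $ i = of_bool (u $ i mod 4 = 2)" by (simp add: T_def bit_lift_def b_def)
      then have "4 dvd u $ i + 2 * T $ i" using False by (cases "u $ i mod 4 = 2") (simp_all, presburger+)
      then have "4 dvd v $ i" by (simp add: v(1))
      then have "v $ i = 0" using v(2)[rule_format, of i] by auto
      then show ?thesis using False by simp
    qed
    then have "v \<odot> v = int (card {i. odd (u $ i)})"
      by (simp add: vdot_def sum_of_bool_eq)
    then show ?thesis
      by (simp add: card_odd_coset[OF z(1), of x, folded u_def] x(2))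
  qed
  ultimately show ?thesis by blast
qed

end

section \<open>The lattice of a code with the prescribed residue and torsion codes\<close>

theorem proposition3p2:
  fixes C :: "(4 ^ 'n::finite) set"
  assumes "CARD('n) = 36"
    and "self_dual_code C"
    and "binary_code 36 6 16 (residue_code C)"
    and "doubly_even (residue_code C)"
    and "has_min_weight (torsion_code C) 3"
  shows "unimodular (construction_A4 C) \<and>
         has_lattice_min (construction_A4 C) 3 \<and>
         has_sigma (construction_A4 C) 20"
proof -
  define M where "M = {x :: int ^ 'n. of_int_vec x \<in> C}"
  have C_eq: "C = of_int_vec ` M"
  proof
    show "C \<subseteq> of_int_vec ` M"
    proof
      fix c assume "c \<in> C"
      moreover obtain x where "of_int_vec x = c" using surj_of_int_vec_4 by blast
      ultimately show "c \<in> of_int_vec ` M" unfolding M_def by blast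
    qed
  qed (auto simp: M_def)
  have "x \<in> M \<longleftrightarrow> (\<forall>y\<in>M. 4 dvd x \<odot> y)" for x
  proof -
    have "x \<in> M \<longleftrightarrow> of_int_vec x \<in> C" by (simp add: M_def)
    also have "\<dots> \<longleftrightarrow> of_int_vec x \<in> dual_code C"
      using assms(2) unfolding self_dual_code_def by metis
    also have "\<dots> \<longleftrightarrow> (\<forall>y\<in>M. of_int_vec x \<odot> (of_int_vec y :: 4 ^ 'n) = 0)"
      unfolding dual_code_def vdot_def[symmetric] C_eq by simp
    finally show ?thesis
      by (simp add: vdot_of_int_vec of_int_4_eq_0_iff)
  qed
  then interpret self_dual_mod_4 M by unfold_locales
  have "residue_code C = vec_mod2 ` C"
    by (auto simp: residue_code_def)
  then have residue: "residue_code C = residue"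
    by (simp add: C_eq residue_def image_image vec_mod2_of_int_vec)
  have scale: "of_int_vec (2 *s x) = 2 *s (of_int_vec x :: 4 ^ 'n)" for x
    by (simp add: vec_eq_iff)
  have torsion: "torsion_code C = torsion"
  proof
    show "torsion \<subseteq> torsion_code C"
    proof
      fix t assume "t \<in> torsion"
      then obtain x where "2 *s x \<in> M" "t = of_int_vec x" by (auto simp: torsion_def)
      then show "t \<in> torsion_code C"
        unfolding torsion_code_def
        by (intro CollectI exI[of _ "of_int_vec x"]) (simp add: vec_mod2_of_int_vec M_def scale)
    qed
    show "torsion_code C \<subseteq> torsion"
    proof
      fix t assume "t \<in> torsion_code C"
      then obtain c where c: "2 *s c \<in> C" "t = vec_mod2 c" by (auto simp: torsion_code_def)
      moreover obtain x where "of_int_vec x = c" using surj_of_int_vec_4 by blast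
      ultimately show "t \<in> torsion"
        unfolding torsion_def
        by (intro CollectI exI[of _ x]) (auto simp: vec_mod2_of_int_vec M_def scale)
    qed
  qed
  have L: "construction_A4 C = half_vec ` M"
    unfolding construction_A4_def half_vec_def M_def of_int_vec_def by blast
  have dim: "vec.dim residue = 6" and min_residue: "has_min_weight residue 16"
    and de: "doubly_even residue" and min_torsion: "has_min_weight torsion 3"
    using assms(3-5) by (simp_all add: residue torsion binary_code_def)
  have res16: "16 \<le> hamming_weight r" if "r \<in> residue" "r \<noteq> 0" for r
    using min_residue that by (auto simp: has_min_weight_def)
  have tor3: "3 \<le> hamming_weight t" if "t \<in> torsion" "t \<noteq> 0" for t
    using min_torsion that by (auto simp: has_min_weight_def)
  \<comment> \<open>The dual of the residue code is the torsion code, whose minimum weight 3 is the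
    dual condition of \<open>hamming_weight_two_valued\<close>.\<close>
  have res20: "hamming_weight r \<le> 20" if "r \<in> residue" for r
  proof (cases "r = 0")
    case False
    have "hamming_weight r = 16 \<or> hamming_weight r = 20"
    proof (rule hamming_weight_two_valued[OF assms(1) subspace_residue dim de])
      fix w :: "bit ^ 'n" assume w: "w \<noteq> 0" "\<And>d. d \<in> residue \<Longrightarrow> w \<odot> d = 0"
      then have "w \<in> torsion" unfolding torsion_dual by (intro ballI)
      then show "3 \<le> hamming_weight w" using w(1) by (rule tor3)
    qed (fact res16 that False)+
    then show ?thesis by auto
  qed (simp add: hamming_weight_def)
  obtain t where t: "t \<in> torsion" "t \<noteq> 0" "hamming_weight t = 3"
    using min_torsion unfolding has_min_weight_def by blast
  \<comment> \<open>Doubling a lift of a torsion word of weight 3 gives squared length 12: norm 3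
    after halving, and a witness of oddness because 8 does not divide 12.\<close>
  define x1 where "x1 = 2 *s bit_lift t"
  have "x1 \<in> M"
    using t(1) unfolding x1_def of_int_vec_mem_torsion_iff[symmetric] by simp
  moreover have "x1 \<odot> x1 = 12"
    by (simp add: x1_def vdot_simps vdot_bit_lift_self t(3))
  ultimately have x1: "x1 \<in> M" "x1 \<odot> x1 = 12" .
  have min: "has_lattice_min (half_vec ` M) 3"
    unfolding has_lattice_min_def is_min_norm_def
  proof
    have "x1 \<noteq> 0" using x1(2) by (auto simp: vdot_simps)
    then have "half_vec x1 \<noteq> 0" by (simp add: vec_eq_iff)
    then have "half_vec x1 \<in> half_vec ` M - {0}" using x1(1) by simp
    then show "\<exists>y\<in>half_vec ` M - {0}. y \<bullet> y = 3"
      by (rule bexI[rotated]) (simp add: inner_half_vec x1)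
    have "3 \<le> half_vec x \<bullet> half_vec x" if "x \<in> M" "half_vec x \<noteq> 0" for x
    proof -
      have "x \<noteq> 0" using that(2) by (auto simp: vec_eq_iff)
      moreover have "12 \<le> hamming_weight r" if "r \<in> residue" "r \<noteq> 0" for r
        using res16[OF that] by simp
      ultimately have "12 \<le> x \<odot> x"
        using vdot_self_ge_12[OF _ tor3 that(1)] by blast
      then have "(12 :: real) \<le> of_int (x \<odot> x)" by linarith
      then show ?thesis by (simp add: inner_half_vec)
    qed
    then show "\<forall>y\<in>half_vec ` M - {0}. 3 \<le> y \<bullet> y" by auto
  qed
  obtain z where z: "\<And>i. odd (z $ i)" "\<And>x. x \<in> M \<Longrightarrow> 8 dvd x \<odot> x - 2 * (z \<odot> x)"
    using exists_odd_characteristic by metis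
  have shadow: "shadow (half_vec ` M) = half_vec ` {v. v - z \<in> M}"
  proof (rule shadow_half_vec[OF z(2) x1(1)])
    show "\<not> 8 dvd x1 \<odot> x1" by (simp add: x1(2))
  qed
  obtain c where c: "c \<in> residue" "hamming_weight c = 16"
    using min_residue unfolding has_min_weight_def by blast
  have c_min: "hamming_weight c \<le> hamming_weight r" if "r \<in> residue" "r \<noteq> 0" for r
    using res16[OF that] c(2) by simp
  have "8 dvd hamming_weight c"
    by (simp add: c(2))
  with z c(1) c_min have "\<exists>v. v - z \<in> M \<and> v \<odot> v = int (CARD('n) - hamming_weight c)"
    by (rule characteristic_attained)
  then obtain v where "v - z \<in> M" "v \<odot> v = int (CARD('n) - hamming_weight c)"
    by blast
  then have v: "v - z \<in> M" "v \<odot> v = 20"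
    by (simp_all add: c(2) assms(1))
  \<comment> \<open>At least 36 - 20 = 16 entries are odd, and 20 is the least integer from 16 on
    that is 4 modulo 8.\<close>
  have ge: "20 \<le> v \<odot> v" if v: "v - z \<in> M" for v
  proof -
    define x where "x = v - z"
    have x: "x \<in> M" "v = z + x" using v by (simp_all add: x_def)
    have "hamming_weight (of_int_vec x) \<le> 20"
      using res20 x(1) by (simp add: residue_def)
    then have "16 \<le> card {i. odd (v $ i)}"
      unfolding x(2) card_odd_coset[OF z(1)] assms(1) by simp
    also have "\<dots> \<le> card {i. v $ i \<noteq> 0}" by (intro card_mono) auto
    finally have "16 \<le> v \<odot> v" using vdot_self_ge_card_nonzero[of v] by linarith
    moreover have "(v \<odot> v) mod 8 = 4"
      using characteristic_vdot_self_cong_8[OF z x(1)] by (simp add: x(2) assms(1) cong_def)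
    ultimately show ?thesis by presburger
  qed
  \<comment> \<open>Halving turns squared length 20 into norm 5, and \<open>has_sigma\<close>
    multiplies by 4 again.\<close>
  have "is_min_norm (shadow (half_vec ` M)) 5"
    unfolding is_min_norm_def
  proof
    show "\<exists>s\<in>shadow (half_vec ` M). s \<bullet> s = 5"
      using v by (auto simp: shadow inner_half_vec intro!: bexI[of _ "half_vec v"])
    have "5 \<le> half_vec w \<bullet> half_vec w" if "w - z \<in> M" for w
    proof -
      have "(20 :: real) \<le> of_int (w \<odot> w)" using ge[OF that] by linarith
      then show ?thesis by (simp add: inner_half_vec)
    qed
    then show "\<forall>s\<in>shadow (half_vec ` M). 5 \<le> s \<bullet> s" by (auto simp: shadow)
  qed
  then have "has_sigma (half_vec ` M) 20"
    unfolding has_sigma_def by (intro exI[of _ 5]) simp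
  with min unimodular_half_vec show ?thesis by (simp add: L)
qed

end
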